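(* Let $k$ be a field and let $r\ge 1$ and $n \geq 1$ be integers. Suppose that there are $(r\times r)$-matrices $a_1,\dots,a_n,b_1,\dots,b_n\in \mathrm{M}_{r,r}(k)$ such that all pairwise commutators are trivial except for $[a_i,b_i]$, $i\in\{1,\dots,n\}$; that is, $[a_i,a_j]=0$ and $[b_i,b_j]=0$ for all $i,j\in\{1,\dots,n\}$, $[a_i,b_j]=0$ for all $i\neq j$, and $[a_i,b_i]\neq 0$ for all $i\in\{1,\dots,n\}$. Then $r\ge n+1$.
   Context: $\mathrm{M}_{r,r}(k)$ is the algebra of $r\times r$ matrices over $k$, and $[x,y]=xy-yx$ denotes the (additive) commutator of matrices. *)

theory Defs
  imports "Jordan_Normal_Form.Matrix"
begin

definition commutator :: "'a :: ring mat \<Rightarrow> 'a mat \<Rightarrow> 'a mat" where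
  "commutator x y = x * y - y * x"

end

theory Submission
  imports Defs "HOL-Computational_Algebra.Polynomial"
begin

text \<open>
  The identity and the given matrices are turned into \<open>2n + 1\<close> linearly independent vectors in a
  space of dimension \<open>2r\<close>; then \<open>2n + 1 \<le> 2r\<close>, hence \<open>n + 1 \<le> r\<close>.

  Suppose that there are a vector \<open>v\<close> and a functional \<open>f\<close> with \<open>f (c v) \<noteq> 0\<close> for every commutator
  \<open>c = [a\<^sub>i, b\<^sub>i]\<close>. A matrix \<open>X\<close> gives the pair \<open>m X = (X v, f X)\<close> of a column and a row. For the
  standard symplectic form \<open>\<omega>\<close> on such pairs, \<open>\<omega> (m X, m Y) = f (X Y v) - f (Y X v) = f ([X, Y] v)\<close>.
  The hypotheses thus say that \<open>m (a\<^sub>i)\<close> and \<open>m (b\<^sub>i)\<close> pair to a nonzero scalar, while all other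
  pairings among these \<open>2n\<close> vectors, and all pairings with \<open>m 1\<close>, vanish. In a linear relation,
  pairing with \<open>m (b\<^sub>i)\<close> therefore kills the coefficient of \<open>m (a\<^sub>i)\<close> and vice versa, and the
  coefficient of \<open>m 1 = (v, f)\<close> vanishes because \<open>v \<noteq> 0\<close>. This is
  \<open>symplectic_partners_card_le\<close>.

  Over a small field \<open>v\<close> and \<open>f\<close> need not exist, but over the polynomial ring \<open>k[t]\<close> they can be
  written down: with \<open>v = (t ^ j)\<^sub>j\<close> and \<open>f = (t ^ (r i))\<^sub>i\<close> the value
  \<open>f (X v) = (\<Sum>i j. X\<^sub>i\<^sub>j t ^ (r i + j))\<close> lists all entries of \<open>X\<close> as coefficients, so it is zero only
  for \<open>X = 0\<close> (\<open>entries_poly_eq_0_iff\<close>). The linear algebra needed is the existence of nontrivial solutions of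
  underdetermined homogeneous systems, which holds over every integral domain
  (\<open>underdetermined_system_nontrivial_solution\<close>).
\<close>

section \<open>Underdetermined homogeneous systems over an integral domain\<close>

text \<open>Gaussian elimination without division: one equation with a nonzero coefficient \<open>A m p\<close> is used
  to remove the unknown \<open>p\<close> from the others, after these are multiplied by \<open>A m p\<close>.\<close>

lemma underdetermined_system_nontrivial_solution:
  fixes A :: "nat \<Rightarrow> 'i \<Rightarrow> 'a::idom"
  assumes "finite I" and "m < card I"
  shows "\<exists>x. (\<exists>i\<in>I. x i \<noteq> 0) \<and> (\<forall>e<m. (\<Sum>i\<in>I. A e i * x i) = 0)"
  using assms
proof (induction m arbitrary: A I)
  case 0
  then have "I \<noteq> {}" by auto
  then show ?case by (intro exI[of _ "\<lambda>_. 1"]) auto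
next
  case (Suc m)
  show ?case
  proof (cases "\<forall>i\<in>I. A m i = 0")
    case True
    obtain x where "\<exists>i\<in>I. x i \<noteq> 0" "\<forall>e<m. (\<Sum>i\<in>I. A e i * x i) = 0"
      using Suc.IH[of I A] Suc.prems by auto
    then show ?thesis using True by (intro exI[of _ x]) (auto simp: less_Suc_eq)
  next
    case False
    then obtain p where p: "p \<in> I" "A m p \<noteq> 0" by auto
    let ?J = "I - {p}"
    have "finite ?J" "m < card ?J" using Suc.prems p by auto
    from Suc.IH[OF this, of "\<lambda>e i. A m p * A e i - A m i * A e p"]
    obtain x where x: "\<exists>i\<in>?J. x i \<noteq> 0"
      and red: "\<And>e. e < m \<Longrightarrow> (\<Sum>i\<in>?J. (A m p * A e i - A m i * A e p) * x i) = 0" by blast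
    define y where "y i = (if i = p then - (\<Sum>i\<in>?J. A m i * x i) else A m p * x i)" for i
    have split: "(\<Sum>i\<in>I. A e i * y i) = (\<Sum>i\<in>?J. (A m p * A e i - A m i * A e p) * x i)" for e
    proof -
      have "(\<Sum>i\<in>I. A e i * y i) = A e p * y p + (\<Sum>i\<in>?J. A e i * y i)"
        using Suc.prems p by (simp add: sum.remove)
      also have "(\<Sum>i\<in>?J. A e i * y i) = (\<Sum>i\<in>?J. A e i * (A m p * x i))"
        by (rule sum.cong) (auto simp: y_def)
      finally show ?thesis
        by (simp add: y_def sum_distrib_left sum_subtractf algebra_simps)
    qed
    have "(\<Sum>i\<in>I. A e i * y i) = 0" if "e < Suc m" for e
    proof (cases "e = m")
      case True
      then show ?thesis unfolding split by (simp add: mult.commute)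
    next
      case False
      then show ?thesis using that red by (simp add: split)
    qed
    moreover have "\<exists>i\<in>I. y i \<noteq> 0" using x p by (auto simp: y_def)
    ultimately show ?thesis by blast
  qed
qed

section \<open>Independence by symplectic pairing\<close>

definition symplectic_form :: "nat \<Rightarrow> (nat \<Rightarrow> 'a) \<times> (nat \<Rightarrow> 'a) \<Rightarrow> (nat \<Rightarrow> 'a) \<times> (nat \<Rightarrow> 'a) \<Rightarrow> 'a::idom"
  where "symplectic_form r p q = (\<Sum>e<r. snd p e * fst q e) - (\<Sum>e<r. snd q e * fst p e)"

text \<open>The vectors \<open>m i\<close> together with \<open>w\<close> are linearly independent: pairing a relation with the
  partner of \<open>m i\<close> isolates the coefficient of \<open>m i\<close>, and what is left is a multiple of \<open>w\<close>.\<close>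

lemma symplectic_partners_card_le:
  fixes m :: "'i \<Rightarrow> (nat \<Rightarrow> 'a::idom) \<times> (nat \<Rightarrow> 'a)"
  assumes fin: "finite J"
    and w: "d < r" "fst w d \<noteq> 0"
    and orth: "\<And>i. i \<in> J \<Longrightarrow> symplectic_form r w (m i) = 0"
    and partner: "\<And>i. i \<in> J \<Longrightarrow> \<exists>j\<in>J. symplectic_form r (m i) (m j) \<noteq> 0 \<and>
                    (\<forall>i'\<in>J - {i}. symplectic_form r (m i') (m j) = 0)"
  shows "card J + 1 \<le> 2 * r"
proof (rule ccontr)
  assume "\<not> card J + 1 \<le> 2 * r"
  define I where "I = insert None (Some ` J)"
  define M where "M o' = (case o' of None \<Rightarrow> w | Some i \<Rightarrow> m i)" for o'
  have "finite I" "card I = card J + 1"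
    using fin by (auto simp: I_def card_image)
  then have "2 * r < card I" using \<open>\<not> card J + 1 \<le> 2 * r\<close> by simp
  \<comment> \<open>The first \<open>r\<close> equations are for the columns, the last \<open>r\<close> for the rows.\<close>
  from underdetermined_system_nontrivial_solution[OF \<open>finite I\<close> this,
      of "\<lambda>e i. if e < r then fst (M i) e else snd (M i) (e - r)"]
  obtain x where x: "\<exists>i\<in>I. x i \<noteq> 0"
    and rel: "\<And>e. e < 2 * r \<Longrightarrow>
      (\<Sum>i\<in>I. (if e < r then fst (M i) e else snd (M i) (e - r)) * x i) = 0" by blast
  have rel1: "(\<Sum>i\<in>I. fst (M i) e * x i) = 0" if "e < r" for e
    using rel[of e] that by simp
  have rel2: "(\<Sum>i\<in>I. snd (M i) e * x i) = 0" if "e < r" for e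
    using rel[of "r + e"] that by simp
  have pair: "(\<Sum>i\<in>I. symplectic_form r (M i) q * x i) = 0" for q
  proof -
    have "(\<Sum>i\<in>I. symplectic_form r (M i) q * x i)
        = (\<Sum>i\<in>I. \<Sum>e<r. fst q e * (snd (M i) e * x i)) - (\<Sum>i\<in>I. \<Sum>e<r. snd q e * (fst (M i) e * x i))"
      by (simp add: symplectic_form_def sum_distrib_left sum_subtractf algebra_simps)
    also have "\<dots> = (\<Sum>e<r. fst q e * (\<Sum>i\<in>I. snd (M i) e * x i))
                   - (\<Sum>e<r. snd q e * (\<Sum>i\<in>I. fst (M i) e * x i))"
      unfolding sum_distrib_left by (simp only: sum.swap[of _ I])
    also have "\<dots> = 0" by (simp add: rel1 rel2)
    finally show ?thesis .
  qed
  have zero: "x (Some i) = 0" if i: "i \<in> J" for i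
  proof -
    obtain j where j: "j \<in> J" "symplectic_form r (m i) (m j) \<noteq> 0"
      "\<And>i'. i' \<in> J \<Longrightarrow> i' \<noteq> i \<Longrightarrow> symplectic_form r (m i') (m j) = 0"
      using partner[OF i] by blast
    have "(\<Sum>i'\<in>I. symplectic_form r (M i') (m j) * x i')
        = (\<Sum>i'\<in>{Some i}. symplectic_form r (M i') (m j) * x i')"
    proof (rule sum.mono_neutral_right)
      show "\<forall>i'\<in>I - {Some i}. symplectic_form r (M i') (m j) * x i' = 0"
      proof
        fix i' assume "i' \<in> I - {Some i}"
        then consider "i' = None" | l where "i' = Some l" "l \<in> J" "l \<noteq> i"
          by (auto simp: I_def)
        then show "symplectic_form r (M i') (m j) * x i' = 0"
          using j(3) orth[OF j(1)] by cases (simp_all add: M_def)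
      qed
    qed (use i \<open>finite I\<close> in \<open>auto simp: I_def\<close>)
    then show ?thesis using pair[of "m j"] j by (simp add: M_def)
  qed
  have "(\<Sum>i\<in>I. fst (M i) d * x i) = (\<Sum>i\<in>{None}. fst (M i) d * x i)"
    by (rule sum.mono_neutral_right) (use zero \<open>finite I\<close> in \<open>auto simp: I_def\<close>)
  then have "x None = 0" using rel1[OF w(1)] w(2) by (simp add: M_def)
  then show False using x zero by (auto simp: I_def)
qed

section \<open>A generic vector and functional with polynomial coordinates\<close>

text \<open>The value \<open>f (X v)\<close> for \<open>v = (t ^ j)\<^sub>j\<close> and \<open>f = (t ^ (r i))\<^sub>i\<close>.\<close>

definition entries_poly :: "nat \<Rightarrow> 'a::comm_ring_1 mat \<Rightarrow> 'a poly"
  where "entries_poly r X = (\<Sum>i<r. \<Sum>j<r. monom (X $$ (i, j)) (r * i + j))"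

text \<open>The pair \<open>(X v, f X)\<close> for the same \<open>v\<close> and \<open>f\<close>.\<close>

definition generic_pair :: "nat \<Rightarrow> 'a::comm_ring_1 mat \<Rightarrow> (nat \<Rightarrow> 'a poly) \<times> (nat \<Rightarrow> 'a poly)"
  where "generic_pair r X =
    (\<lambda>e. \<Sum>j<r. monom (X $$ (e, j)) j, \<lambda>e. \<Sum>i<r. monom (X $$ (i, e)) (r * i))"

text \<open>Distinct positions \<open>(i, j)\<close> contribute to distinct degrees \<open>r i + j\<close>, by division with remainder.\<close>

lemma coeff_entries_poly:
  assumes "i < r" "j < r"
  shows "coeff (entries_poly r X) (r * i + j) = X $$ (i, j)"
proof -
  have inj: "r * i' + j' = r * i + j \<longleftrightarrow> i' = i \<and> j' = j" if "j' < r" for i' j'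
  proof
    assume eq: "r * i' + j' = r * i + j"
    have "(r * i' + j') div r = i'" "(r * i + j) div r = i"
      using that assms by auto
    with eq show "i' = i \<and> j' = j" by auto
  qed simp
  have "coeff (entries_poly r X) (r * i + j)
      = (\<Sum>i'<r. \<Sum>j'<r. if i' = i then if j' = j then X $$ (i', j') else 0 else 0)"
    unfolding entries_poly_def coeff_sum coeff_monom
    by (intro sum.cong refl) (auto simp: inj)
  also have "\<dots> = (\<Sum>i'<r. if i' = i then X $$ (i', j) else 0)"
    using assms by (intro sum.cong refl) auto
  also have "\<dots> = X $$ (i, j)" using assms by simp
  finally show ?thesis .
qed

lemma entries_poly_eq_0_iff:
  assumes "X \<in> carrier_mat r r"
  shows "entries_poly r X = 0 \<longleftrightarrow> X = 0\<^sub>m r r"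
proof
  assume "entries_poly r X = 0"
  then show "X = 0\<^sub>m r r"
    using assms coeff_entries_poly[of _ r _ X] by (intro eq_matI) auto
qed (simp add: entries_poly_def)

lemma entries_poly_minus:
  assumes "X \<in> carrier_mat r r" "Y \<in> carrier_mat r r"
  shows "entries_poly r (X - Y) = entries_poly r X - entries_poly r Y"
  using assms by (simp add: entries_poly_def sum_subtractf[symmetric] diff_monom)

lemma entries_poly_mult:
  assumes "X \<in> carrier_mat r r" "Y \<in> carrier_mat r r"
  shows "(\<Sum>e<r. snd (generic_pair r X) e * fst (generic_pair r Y) e) = entries_poly r (X * Y)"
proof -
  have entry: "(X * Y) $$ (i, j) = (\<Sum>e<r. X $$ (i, e) * Y $$ (e, j))" if "i < r" "j < r" for i j
    using assms that by (simp add: scalar_prod_def lessThan_atLeast0)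
  have monom_sum: "monom (sum h A) d = (\<Sum>e\<in>A. monom (h e) d)" for h :: "nat \<Rightarrow> 'a" and A d
    by (induction A rule: infinite_finite_induct) (auto simp: add_monom[symmetric])
  have "(\<Sum>e<r. snd (generic_pair r X) e * fst (generic_pair r Y) e)
      = (\<Sum>e<r. \<Sum>i<r. \<Sum>j<r. monom (X $$ (i, e) * Y $$ (e, j)) (r * i + j))"
    by (simp add: generic_pair_def sum_product mult_monom)
  also have "\<dots> = (\<Sum>i<r. \<Sum>e<r. \<Sum>j<r. monom (X $$ (i, e) * Y $$ (e, j)) (r * i + j))"
    by (rule sum.swap)
  also have "\<dots> = (\<Sum>i<r. \<Sum>j<r. \<Sum>e<r. monom (X $$ (i, e) * Y $$ (e, j)) (r * i + j))"
    by (intro sum.cong refl sum.swap)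
  also have "\<dots> = entries_poly r (X * Y)"
    unfolding entries_poly_def by (intro sum.cong refl) (simp add: entry monom_sum del: index_mult_mat)
  finally show ?thesis .
qed

lemma symplectic_form_generic_pair:
  fixes X Y :: "'a::idom mat"
  assumes "X \<in> carrier_mat r r" "Y \<in> carrier_mat r r"
  shows "symplectic_form r (generic_pair r X) (generic_pair r Y) = entries_poly r (commutator X Y)"
  using assms
  by (simp add: symplectic_form_def entries_poly_mult commutator_def entries_poly_minus[of _ r])

lemma symplectic_form_generic_pair_eq_0_iff:
  fixes X Y :: "'a::idom mat"
  assumes "X \<in> carrier_mat r r" "Y \<in> carrier_mat r r"
  shows "symplectic_form r (generic_pair r X) (generic_pair r Y) = 0 \<longleftrightarrow> commutator X Y = 0\<^sub>m r r"
proof -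
  have "commutator X Y \<in> carrier_mat r r" using assms by (auto simp: commutator_def)
  then show ?thesis by (simp add: symplectic_form_generic_pair[OF assms] entries_poly_eq_0_iff)
qed

section \<open>Families of matrices with prescribed commutators\<close>

text \<open>The identity matrix commutes with the whole family and yields a nonzero vector, which is where
  the summand \<open>1\<close> comes from.\<close>

lemma noncommuting_partners_card_le:
  fixes Y :: "'i \<Rightarrow> 'a::idom mat"
  assumes fin: "finite J" and r: "r \<ge> 1"
    and carr: "\<And>i. i \<in> J \<Longrightarrow> Y i \<in> carrier_mat r r"
    and partner: "\<And>i. i \<in> J \<Longrightarrow> \<exists>j\<in>J. commutator (Y i) (Y j) \<noteq> 0\<^sub>m r r \<and>
                    (\<forall>i'\<in>J - {i}. commutator (Y i') (Y j) = 0\<^sub>m r r)"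
  shows "card J + 1 \<le> 2 * r"
proof (rule symplectic_partners_card_le[where d = 0 and w = "generic_pair r (1\<^sub>m r)"
      and m = "\<lambda>i. generic_pair r (Y i)"])
  have "coeff (fst (generic_pair r (1\<^sub>m r :: 'a mat)) 0) 0 = 1"
    using r by (simp add: generic_pair_def coeff_sum)
  then show "fst (generic_pair r (1\<^sub>m r :: 'a mat)) 0 \<noteq> 0" by auto
next
  fix i assume "i \<in> J"
  then show "symplectic_form r (generic_pair r (1\<^sub>m r)) (generic_pair r (Y i)) = 0"
    using carr[of i] by (simp add: symplectic_form_generic_pair_eq_0_iff commutator_def)
next
  fix i assume i: "i \<in> J"
  then obtain j where j: "j \<in> J" "commutator (Y i) (Y j) \<noteq> 0\<^sub>m r r"
    "\<And>i'. i' \<in> J - {i} \<Longrightarrow> commutator (Y i') (Y j) = 0\<^sub>m r r"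
    using partner[OF i] by blast
  then show "\<exists>j\<in>J. symplectic_form r (generic_pair r (Y i)) (generic_pair r (Y j)) \<noteq> 0 \<and>
      (\<forall>i'\<in>J - {i}. symplectic_form r (generic_pair r (Y i')) (generic_pair r (Y j)) = 0)"
    using i carr by (intro bexI[of _ j]) (auto simp: symplectic_form_generic_pair_eq_0_iff)
qed (use fin r in auto)

lemma commutator_swap_eq_0:
  assumes "x \<in> carrier_mat r r" "y \<in> carrier_mat r r" "commutator x y = 0\<^sub>m r r"
  shows "commutator y x = 0\<^sub>m r r"
proof -
  have "commutator y x = - commutator x y"
    unfolding commutator_def using assms by (intro eq_matI) auto
  then show ?thesis using assms(3) by (intro eq_matI) auto
qed

theorem theorem2:
  fixes a b :: "nat \<Rightarrow> 'k :: field mat"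
    and r n :: nat
  assumes "r \<ge> 1" and "n \<ge> 1"
    and "\<And>i. i \<in> {1..n} \<Longrightarrow> a i \<in> carrier_mat r r"
    and "\<And>i. i \<in> {1..n} \<Longrightarrow> b i \<in> carrier_mat r r"
    and "\<And>i j. i \<in> {1..n} \<Longrightarrow> j \<in> {1..n} \<Longrightarrow> commutator (a i) (a j) = 0\<^sub>m r r"
    and "\<And>i j. i \<in> {1..n} \<Longrightarrow> j \<in> {1..n} \<Longrightarrow> commutator (b i) (b j) = 0\<^sub>m r r"
    and "\<And>i j. i \<in> {1..n} \<Longrightarrow> j \<in> {1..n} \<Longrightarrow> i \<noteq> j \<Longrightarrow> commutator (a i) (b j) = 0\<^sub>m r r"
    and "\<And>i. i \<in> {1..n} \<Longrightarrow> commutator (a i) (b i) \<noteq> 0\<^sub>m r r"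
  shows "r \<ge> n + 1"
proof -
  note carr = assms(3,4) and aa = assms(5) and bb = assms(6) and ab = assms(7) and ne = assms(8)
  have ba: "commutator (b i) (a j) = 0\<^sub>m r r" if "i \<in> {1..n}" "j \<in> {1..n}" "i \<noteq> j" for i j
    using commutator_swap_eq_0[OF carr(1) carr(2) ab] that by blast
  have ne': "commutator (b i) (a i) \<noteq> 0\<^sub>m r r" if "i \<in> {1..n}" for i
    using commutator_swap_eq_0[OF carr(2) carr(1)] ne that by blast
  let ?J = "{1..n} <+> {1..n}" and ?Y = "case_sum a b"
  have "card ?J + 1 \<le> 2 * r"
  proof (rule noncommuting_partners_card_le[where Y = ?Y])
    fix i assume "i \<in> ?J"
    then show "\<exists>j\<in>?J. commutator (?Y i) (?Y j) \<noteq> 0\<^sub>m r r \<and>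
                 (\<forall>i'\<in>?J - {i}. commutator (?Y i') (?Y j) = 0\<^sub>m r r)"
    proof (elim PlusE)
      fix l assume l: "l \<in> {1..n}" "i = Inl l"
      then show ?thesis
        by (intro bexI[of _ "Inr l"]) (use ne ab bb in \<open>auto simp del: atLeastAtMost_iff\<close>)
    next
      fix l assume l: "l \<in> {1..n}" "i = Inr l"
      then show ?thesis
        by (intro bexI[of _ "Inl l"]) (use ne' ba aa in \<open>auto simp del: atLeastAtMost_iff\<close>)
    qed
  qed (use assms(1) carr in \<open>auto simp del: atLeastAtMost_iff\<close>)
  then show ?thesis by (simp add: card_Plus)
qed

end
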